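(* Let $b_1,\dots,b_N>0$. Let $\alpha,\beta,\gamma,\delta$ be labels with associated complex numbers $\xi_\alpha,\xi_\beta,\xi_\gamma,\xi_\delta$, none of which equals $1/b_l$ for any $l\in\{1,\dots,N\}$. The matrices $\mathbf{T}_i(\cdot,\cdot)$, $1\le i\le N-1$, satisfy the following consistency relations, for $i,j\in\{1,\dots,N-1\}$: (a) $\mathbf{T}_i(\beta,\alpha)\,\mathbf{T}_j(\delta,\gamma)=\mathbf{T}_j(\delta,\gamma)\,\mathbf{T}_i(\beta,\alpha)$ if $|i-j|\ge 2$; (b) $\mathbf{T}_i(\gamma,\beta)\,\mathbf{T}_j(\gamma,\alpha)\,\mathbf{T}_i(\beta,\alpha)=\mathbf{T}_j(\beta,\alpha)\,\mathbf{T}_i(\gamma,\alpha)\,\mathbf{T}_j(\gamma,\beta)$ if $|i-j|=1$; (c) $\mathbf{T}_i(\beta,\alpha)\,\mathbf{T}_i(\alpha,\beta)=\mathbf{I}_{N^N}$.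
   Context: The numbers $b_1,\dots,b_N$ are the jump rates of the species $1,\dots,N$ in the multi-species totally asymmetric simple exclusion process with $N$ particles. Rows and columns of an $N^n\times N^n$ matrix are labelled by the words in $\{1,\dots,N\}^n$ in lexicographic order $1\cdots1,\dots,N\cdots N$; $\mathbf{I}_m$ is the $m\times m$ identity matrix, and $\otimes$ is the tensor (Kronecker) product of matrices compatible with this labelling. For labels $\alpha,\beta$ with associated complex numbers $\xi_\alpha,\xi_\beta$ put $$S_{\beta\alpha}(i)=-\frac{1-b_i\xi_\beta}{1-b_i\xi_\alpha},\qquad T_{\beta\alpha}(i)=\frac{b_i(\xi_\beta-\xi_\alpha)}{1-b_i\xi_\alpha},\qquad 1\le i\le N.$$ $\mathbf{R}_{\beta\alpha}=[R_{ij,kl}]$ is the $N^2\times N^2$ matrix (row label $ij$, column label $kl$) with $R_{ij,kl}=S_{\beta\alpha}(i)$ if $ij=kl$ and $i\le j$; $R_{ij,kl}=-1$ if $ij=kl$ and $i>j$; $R_{ij,kl}=T_{\beta\alpha}(i)$ if $ij=lk$ and $i<j$; and $R_{ij,kl}=0$ in all other cases. For $1\le l\le N-1$, $\mathbf{T}_l(\beta,\alpha)$ is the $N^N\times N^N$ matrix $$\mathbf{T}_l(\beta,\alpha)=\underbrace{\mathbf{I}_N\otimes\cdots\otimes\mathbf{I}_N}_{l-1}\otimes\,\mathbf{R}_{\beta\alpha}\otimes\underbrace{\mathbf{I}_N\otimes\cdots\otimes\mathbf{I}_N}_{N-l-1}.$$ It corresponds to the simple transposition that interchanges the entries in slots $l$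 and $l+1$ and takes a permutation $(\cdots\alpha\beta\cdots)$ to $(\cdots\beta\alpha\cdots)$.
   Formalization: Part (b) is proved only for j = i+1; for i = j+1 it is false in general when the rates differ, e.g. N=3, b=(1,2,1), ξ_α=0, ξ_β=2, ξ_γ=3, i=2, j=1: the entry in row 122, column 212 is −5 on the left and −9 on the right. *)

theory Defs
  imports "Jordan_Normal_Form.Matrix"
begin

text \<open>The two-letter words \<open>ij\<close> over \<open>{1,...,N}\<close>, in lexicographic order, label the
  matrix indices \<open>0,...,N\<^sup>2 - 1\<close>.\<close>

definition word2 :: "nat \<Rightarrow> nat \<Rightarrow> nat \<times> nat" where
  "word2 N r = (r div N + 1, r mod N + 1)"

text \<open>Labels are elements of an arbitrary type, and \<open>\<xi>\<close> maps a label to its complex number.\<close>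

definition S_coeff :: "(nat \<Rightarrow> real) \<Rightarrow> ('l \<Rightarrow> complex) \<Rightarrow> 'l \<Rightarrow> 'l \<Rightarrow> nat \<Rightarrow> complex" where
  "S_coeff b \<xi> \<beta> \<alpha> i =
     - ((1 - complex_of_real (b i) * \<xi> \<beta>) / (1 - complex_of_real (b i) * \<xi> \<alpha>))"

definition T_coeff :: "(nat \<Rightarrow> real) \<Rightarrow> ('l \<Rightarrow> complex) \<Rightarrow> 'l \<Rightarrow> 'l \<Rightarrow> nat \<Rightarrow> complex" where
  "T_coeff b \<xi> \<beta> \<alpha> i =
     (complex_of_real (b i) * (\<xi> \<beta> - \<xi> \<alpha>)) / (1 - complex_of_real (b i) * \<xi> \<alpha>)"

fun R_entry :: "(nat \<Rightarrow> real) \<Rightarrow> ('l \<Rightarrow> complex) \<Rightarrow> 'l \<Rightarrow> 'l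
    \<Rightarrow> nat \<times> nat \<Rightarrow> nat \<times> nat \<Rightarrow> complex" where
  "R_entry b \<xi> \<beta> \<alpha> (i, j) (k, l) =
     (if (i, j) = (k, l) \<and> i \<le> j then S_coeff b \<xi> \<beta> \<alpha> i
      else if (i, j) = (k, l) \<and> i > j then - 1
      else if (i, j) = (l, k) \<and> i < j then T_coeff b \<xi> \<beta> \<alpha> i
      else 0)"

definition R_mat :: "nat \<Rightarrow> (nat \<Rightarrow> real) \<Rightarrow> ('l \<Rightarrow> complex) \<Rightarrow> 'l \<Rightarrow> 'l \<Rightarrow> complex mat" where
  "R_mat N b \<xi> \<beta> \<alpha> =
     mat (N * N) (N * N) (\<lambda>(r, c). R_entry b \<xi> \<beta> \<alpha> (word2 N r) (word2 N c))"

text \<open>The row index of \<open>A \<otimes> B\<close> belonging to row \<open>p\<close> of \<open>A\<close> and row \<open>q\<close> of \<open>B\<close> is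
  \<open>p * dim_row B + q\<close>, and likewise for columns, so concatenation of words corresponds to
  the lexicographic order.\<close>

definition kron :: "'a::comm_semiring_1 mat \<Rightarrow> 'a mat \<Rightarrow> 'a mat" where
  "kron A B = mat (dim_row A * dim_row B) (dim_col A * dim_col B)
     (\<lambda>(r, c). A $$ (r div dim_row B, c div dim_col B) * B $$ (r mod dim_row B, c mod dim_col B))"

definition kron_list :: "'a::comm_semiring_1 mat list \<Rightarrow> 'a mat" where
  "kron_list As = foldr kron As (1\<^sub>m 1)"

text \<open>Meant for \<open>1 \<le> l \<le> N - 1\<close>. The matrix \<open>T_mat N b \<xi> l \<beta> \<alpha>\<close> stands for the step from an
  arrangement of labels with \<open>\<alpha>\<close>, \<open>\<beta>\<close> in slots \<open>l\<close>, \<open>l + 1\<close> to the one with \<open>\<beta>\<close>, \<open>\<alpha>\<close> there;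
  the rightmost factor of a product is the first step. In the braid relation
  \<open>T\<^sub>i(\<gamma>,\<beta>) T\<^sub>j(\<gamma>,\<alpha>) T\<^sub>i(\<beta>,\<alpha>) = T\<^sub>j(\<beta>,\<alpha>) T\<^sub>i(\<gamma>,\<alpha>) T\<^sub>j(\<gamma>,\<beta>)\<close>
  the steps lead from \<open>\<alpha>\<beta>\<gamma>\<close> to \<open>\<gamma>\<beta>\<alpha>\<close> exactly when the adjacent indices satisfy \<open>j = i + 1\<close>.
  For \<open>i = j + 1\<close> the steps do not compose, and the identity fails in general when the
  rates are not all equal (for instance \<open>N = 3\<close>, \<open>b = (1, 2, 1)\<close>, \<open>\<xi>\<^sub>\<alpha> = 0\<close>, \<open>\<xi>\<^sub>\<beta> = 2\<close>, \<open>\<xi>\<^sub>\<gamma> = 3\<close>).\<close>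

definition T_mat ::
    "nat \<Rightarrow> (nat \<Rightarrow> real) \<Rightarrow> ('l \<Rightarrow> complex) \<Rightarrow> nat \<Rightarrow> 'l \<Rightarrow> 'l \<Rightarrow> complex mat" where
  "T_mat N b \<xi> l \<beta> \<alpha> =
     kron_list (replicate (l - 1) (1\<^sub>m N) @ [R_mat N b \<xi> \<beta> \<alpha>] @ replicate (N - l - 1) (1\<^sub>m N))"

lemma kron_carrier:
  "A \<in> carrier_mat m n \<Longrightarrow> B \<in> carrier_mat p q \<Longrightarrow> kron A B \<in> carrier_mat (m * p) (n * q)"
  by (auto simp: kron_def)

lemma T_mat_carrier:
  assumes "l \<in> {1..N - 1}"
  shows "T_mat N b \<xi> l \<beta> \<alpha> \<in> carrier_mat (N ^ N) (N ^ N)"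
proof -
  have ones: "foldr kron (replicate k (1\<^sub>m N)) A \<in> carrier_mat (N ^ k * m) (N ^ k * m)"
    if "A \<in> carrier_mat m m" for k m and A :: "complex mat"
  proof (induction k)
    case 0
    show ?case using that by simp
  next
    case (Suc k)
    then show ?case
      using kron_carrier[OF one_carrier_mat[of N] Suc.IH] by (simp add: mult.assoc)
  qed
  have R: "R_mat N b \<xi> \<beta> \<alpha> \<in> carrier_mat (N * N) (N * N)"
    by (simp add: R_mat_def)
  have exponent: "(l - 1) + (2 + (N - l - 1)) = N"
    using assms by auto
  have "N ^ (l - 1) * (N * N * (N ^ (N - l - 1) * 1)) = N ^ ((l - 1) + (2 + (N - l - 1)))"
    by (simp add: power_add power2_eq_square mult.assoc)
  also have "\<dots> = N ^ N"
    by (simp only: exponent)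
  finally show ?thesis
    using ones[OF kron_carrier[OF R ones[OF one_carrier_mat[of 1], of "N - l - 1"]], of "l - 1"]
    by (simp add: T_mat_def kron_list_def)
qed

end

theory Submission
  imports Defs
begin

text \<open>Since the Kronecker product is multiplicative and associative and
  \<open>I\<^sub>m \<otimes> I\<^sub>n = I\<^sub>m\<^sub>n\<close>, identity factors can be merged and split freely. Every relation between
  the matrices \<open>T\<^sub>l\<close> therefore reduces to the slots on which they act. For distant slots, the two
  matrices are \<open>A \<otimes> I\<close> and \<open>I \<otimes> B\<close> up to common identity factors, and both products are
  \<open>A \<otimes> B\<close>, whatever the entries (\<open>T_mat_commute\<close>). The relation for one
  \<open>T\<^sub>l\<close> is a statement about \<open>R\<close> on two slots (\<open>two_slot_mat_inverse\<close>), and the braid relation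
  is one about \<open>R \<otimes> I\<close> and \<open>I \<otimes> R\<close> on three slots (\<open>two_slot_mat_braid\<close>).

  The coefficients of \<open>R\<close> enter these two statements only through three facts. First,
  \<open>T\<^sub>\<beta>\<^sub>\<alpha>(i) = 1 + S\<^sub>\<beta>\<^sub>\<alpha>(i)\<close>, so \<open>R\<close> is determined by the function \<open>S\<^sub>\<beta>\<^sub>\<alpha>\<close>. Second,
  \<open>S\<^sub>\<gamma>\<^sub>\<beta>(i) S\<^sub>\<beta>\<^sub>\<alpha>(i) = - S\<^sub>\<gamma>\<^sub>\<alpha>(i)\<close>, because \<open>- S\<close> is a quotient of the values \<open>1 - b\<^sub>i \<xi>\<close> at two
  labels; the case \<open>\<gamma> = \<alpha>\<close> says that \<open>S\<^sub>\<alpha>\<^sub>\<beta>(i)\<close> and \<open>S\<^sub>\<beta>\<^sub>\<alpha>(i)\<close> are inverse to each other. Third,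
  \<open>T\<^sub>\<beta>\<^sub>\<alpha>(i) T\<^sub>\<gamma>\<^sub>\<alpha>(j) = T\<^sub>\<beta>\<^sub>\<alpha>(j) T\<^sub>\<gamma>\<^sub>\<alpha>(i)\<close>, because \<open>T\<^sub>\<beta>\<^sub>\<alpha>(i)\<close> is the product of
  \<open>\<xi>\<^sub>\<beta> - \<xi>\<^sub>\<alpha>\<close> and a factor depending only on \<open>\<alpha>\<close> and \<open>i\<close>.

  Each row of \<open>R\<close> has at most two nonzero entries, one for keeping the word and one for swapping
  its letters. Multiplication by \<open>R \<otimes> I\<close> or \<open>I \<otimes> R\<close> is therefore a two-term operation on functions
  of three letters, and the braid relation can be checked one word at a time. For most orders of
  the letters of the word the two sides agree by the second fact alone; for the others, their
  difference is a multiple of the difference of the two sides of the third fact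
  (\<open>act_braid\<close>).\<close>

section \<open>The Kronecker product\<close>

lemma mult_add_less_mult:
  fixes a b m n :: nat
  assumes "a < n" "b < m"
  shows "a * m + b < n * m"
proof -
  have "a * m + b < Suc a * m"
    using assms by simp
  also have "\<dots> \<le> n * m"
    using assms by (intro mult_right_mono) auto
  finally show ?thesis .
qed

lemma eq_mult_add_iff:
  fixes a b c m :: nat
  assumes "b < m"
  shows "c = a * m + b \<longleftrightarrow> c div m = a \<and> c mod m = b"
  using assms by auto

lemma mult_add_eq_mult_add_iff:
  fixes a b c d m :: nat
  assumes "b < m" "d < m"
  shows "a * m + b = c * m + d \<longleftrightarrow> a = c \<and> b = d"
  using assms by (simp add: eq_mult_add_iff)

text \<open>The index of a Kronecker product encodes a pair of indices by quotient and remainder, so the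
  sum in a matrix product over such an index is a double sum, which splits into two factors.\<close>

lemma sum_lessThan_mult_div_mod:
  fixes f :: "nat \<Rightarrow> nat \<Rightarrow> 'a::comm_monoid_add"
  shows "(\<Sum>t = 0..<n * m. f (t div m) (t mod m)) = (\<Sum>a = 0..<n. \<Sum>c = 0..<m. f a c)"
proof (cases "m = 0")
  case False
  have "(\<Sum>a = 0..<n. \<Sum>c = 0..<m. f a c) = (\<Sum>(a, c)\<in>{0..<n} \<times> {0..<m}. f a c)"
    by (rule sum.cartesian_product)
  also have "\<dots> = (\<Sum>t = 0..<n * m. f (t div m) (t mod m))"
    by (rule sum.reindex_bij_witness[where i = "\<lambda>t. (t div m, t mod m)"
          and j = "\<lambda>(a, c). a * m + c"])
      (use False in \<open>auto simp: mult_add_less_mult less_mult_imp_div_less\<close>)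
  finally show ?thesis ..
qed simp

lemma index_kron:
  assumes "A \<in> carrier_mat m n" "B \<in> carrier_mat p q" "r < m * p" "c < n * q"
  shows "kron A B $$ (r, c) = A $$ (r div p, c div q) * B $$ (r mod p, c mod q)"
  using assms by (auto simp: kron_def)

lemma kron_mult_kron:
  assumes A: "A \<in> carrier_mat m n" and C: "C \<in> carrier_mat n k"
    and B: "B \<in> carrier_mat p q" and D: "D \<in> carrier_mat q l"
  shows "kron A B * kron C D = kron (A * C) (B * D)"
proof (rule eq_matI)
  note AB = kron_carrier[OF A B] and CD = kron_carrier[OF C D]
  have AC: "A * C \<in> carrier_mat m k" and BD: "B * D \<in> carrier_mat p l"
    using A B C D by auto
  show "dim_row (kron A B * kron C D) = dim_row (kron (A * C) (B * D))"
    and "dim_col (kron A B * kron C D) = dim_col (kron (A * C) (B * D))"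
    using AB CD kron_carrier[OF AC BD] by auto
  fix r c
  assume "r < dim_row (kron (A * C) (B * D))" "c < dim_col (kron (A * C) (B * D))"
  then have r: "r < m * p" and c: "c < k * l"
    using kron_carrier[OF AC BD] by auto
  then have "p > 0" "l > 0"
    by (auto intro!: Nat.gr0I)
  with r c have bounds: "r div p < m" "r mod p < p" "c div l < k" "c mod l < l"
    by (auto simp: less_mult_imp_div_less)
  have "(kron A B * kron C D) $$ (r, c)
      = (\<Sum>t = 0..<n * q. kron A B $$ (r, t) * kron C D $$ (t, c))"
    using AB CD r c by (auto simp: scalar_prod_def)
  also have "\<dots> = (\<Sum>t = 0..<n * q. (A $$ (r div p, t div q) * C $$ (t div q, c div l)) *
      (B $$ (r mod p, t mod q) * D $$ (t mod q, c mod l)))"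
    by (rule sum.cong) (use r c in \<open>auto simp: index_kron[OF A B] index_kron[OF C D] mult_ac\<close>)
  also have "\<dots> = (A * C) $$ (r div p, c div l) * (B * D) $$ (r mod p, c mod l)"
    using A B C D bounds by (simp add: sum_lessThan_mult_div_mod[where
          f = "\<lambda>a d. (A $$ (r div p, a) * C $$ (a, c div l)) * (B $$ (r mod p, d) * D $$ (d, c mod l))"]
        sum_product scalar_prod_def)
  also have "\<dots> = kron (A * C) (B * D) $$ (r, c)"
    using index_kron[OF AC BD r c] ..
  finally show "(kron A B * kron C D) $$ (r, c) = kron (A * C) (B * D) $$ (r, c)" .
qed

lemma kron_assoc: "kron (kron A B) C = kron A (kron B C)"
proof (rule eq_matI)
  fix r c
  assume "r < dim_row (kron A (kron B C))" "c < dim_col (kron A (kron B C))"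
  then have r: "r < dim_row A * dim_row B * dim_row C"
    and c: "c < dim_col A * dim_col B * dim_col C"
    by (auto simp: kron_def mult.assoc)
  then have pos: "dim_row B > 0" "dim_row C > 0" "dim_col B > 0" "dim_col C > 0"
    by (auto intro!: Nat.gr0I)
  have "r div dim_row C < dim_row A * dim_row B" "c div dim_col C < dim_col A * dim_col B"
    using r c by (auto simp: less_mult_imp_div_less)
  moreover have "r mod (dim_row B * dim_row C) < dim_row B * dim_row C"
    "c mod (dim_col B * dim_col C) < dim_col B * dim_col C"
    using pos by auto
  moreover have "r div (dim_row B * dim_row C) = r div dim_row C div dim_row B"
    "c div (dim_col B * dim_col C) = c div dim_col C div dim_col B"
    by (metis div_mult2_eq mult.commute)+
  moreover have "r mod (dim_row B * dim_row C) div dim_row C = r div dim_row C mod dim_row B"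
    "c mod (dim_col B * dim_col C) div dim_col C = c div dim_col C mod dim_col B"
    using pos by (simp_all add: mod_mult2_eq mult.commute[of "dim_row B"] mult.commute[of "dim_col B"])
  moreover have "r mod (dim_row B * dim_row C) mod dim_row C = r mod dim_row C"
    "c mod (dim_col B * dim_col C) mod dim_col C = c mod dim_col C"
    by (simp_all add: mod_mod_cancel)
  ultimately show "kron (kron A B) C $$ (r, c) = kron A (kron B C) $$ (r, c)"
    using r c by (simp add: kron_def mult.assoc)
qed (auto simp: kron_def)

lemma kron_one_one: "kron (1\<^sub>m m) (1\<^sub>m n) = 1\<^sub>m (m * n)"
proof (rule eq_matI)
  fix r c
  assume "r < dim_row (1\<^sub>m (m * n) :: 'a mat)" "c < dim_col (1\<^sub>m (m * n) :: 'a mat)"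
  then have "r < m * n" "c < m * n" "n > 0"
    by (auto intro!: Nat.gr0I)
  moreover have "r = c \<longleftrightarrow> r div n = c div n \<and> r mod n = c mod n"
    by (metis div_mult_mod_eq)
  ultimately show "kron (1\<^sub>m m) (1\<^sub>m n) $$ (r, c) = (1\<^sub>m (m * n) :: 'a mat) $$ (r, c)"
    by (auto simp: kron_def less_mult_imp_div_less)
qed (auto simp: kron_def)

lemma kron_one_left: "kron (1\<^sub>m 1) A = A"
  by (rule eq_matI) (auto simp: kron_def)

lemma kron_one_right: "kron A (1\<^sub>m 1) = A"
  by (rule eq_matI) (auto simp: kron_def)

lemma kron_one_mult_left: "kron (1\<^sub>m (k * l)) A = kron (1\<^sub>m k) (kron (1\<^sub>m l) A)"
  by (simp add: kron_assoc flip: kron_one_one)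

lemma foldr_kron_replicate_one: "foldr kron (replicate k (1\<^sub>m N)) A = kron (1\<^sub>m (N ^ k)) A"
  by (induction k) (simp_all add: kron_one_left[unfolded One_nat_def] kron_one_mult_left)

lemma kron_commute:
  assumes A: "A \<in> carrier_mat m m" and B: "B \<in> carrier_mat n n"
  shows "kron A (1\<^sub>m n) * kron (1\<^sub>m m) B = kron (1\<^sub>m m) B * kron A (1\<^sub>m n)"
  using kron_mult_kron[OF A one_carrier_mat one_carrier_mat B]
    kron_mult_kron[OF one_carrier_mat A B one_carrier_mat] A B
  by simp

text \<open>An operator on the middle slots of a word; \<open>p\<close> and \<open>q\<close> are the numbers of words in the slots
  before and after them.\<close>

definition pad :: "nat \<Rightarrow> nat \<Rightarrow> 'a::comm_semiring_1 mat \<Rightarrow> 'a mat" where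
  "pad p q A = kron (1\<^sub>m p) (kron A (1\<^sub>m q))"

lemma pad_mult:
  assumes A: "A \<in> carrier_mat n n" and B: "B \<in> carrier_mat n n"
  shows "pad p q A * pad p q B = pad p q (A * B)"
  using kron_mult_kron[OF one_carrier_mat one_carrier_mat
      kron_carrier[OF A one_carrier_mat] kron_carrier[OF B one_carrier_mat], of p q]
    kron_mult_kron[OF A B one_carrier_mat one_carrier_mat, of q]
  by (simp add: pad_def)

lemma pad_one: "pad p q (1\<^sub>m n) = 1\<^sub>m (p * (n * q))"
  by (simp add: pad_def kron_one_one)

text \<open>These two rules enlarge the block on which an operator acts, so that operators at neighbouring
  positions can be compared on a common block.\<close>

lemma pad_mult_left: "pad (p * n) q A = pad p q (kron (1\<^sub>m n) A)"
  by (simp add: pad_def kron_one_mult_left kron_assoc)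

lemma pad_mult_right: "pad p (n * q) A = pad p q (kron A (1\<^sub>m n))"
  by (simp add: pad_def kron_assoc kron_one_one)

lemma T_mat_eq_pad:
  "T_mat N b \<xi> l \<beta> \<alpha> = pad (N ^ (l - 1)) (N ^ (N - l - 1)) (R_mat N b \<xi> \<beta> \<alpha>)"
  by (simp add: pad_def T_mat_def kron_list_def foldr_kron_replicate_one kron_one_right[unfolded One_nat_def]
      del: foldr_replicate)

text \<open>Both sides are \<open>I \<otimes> (A \<otimes> B)\<close>, where \<open>A\<close> acts on the slots \<open>i\<close>, \<open>i + 1\<close> and \<open>B\<close> on all the
  slots after them, including \<open>j\<close> and \<open>j + 1\<close>.\<close>

lemma T_mat_commute:
  assumes "1 \<le> i" "i + 2 \<le> j" "j \<le> N - 1"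
  shows "T_mat N b \<xi> i \<beta> \<alpha> * T_mat N b \<xi> j \<delta> \<gamma> = T_mat N b \<xi> j \<delta> \<gamma> * T_mat N b \<xi> i \<beta> \<alpha>"
proof -
  define p q r where "p = N ^ (i - 1)" and "q = N ^ (j - i - 2)" and "r = N ^ (N - j - 1)"
  define A where "A = R_mat N b \<xi> \<beta> \<alpha>"
  define B where "B = kron (1\<^sub>m q) (kron (R_mat N b \<xi> \<delta> \<gamma>) (1\<^sub>m r))"
  \<comment> \<open>The number of words in the slots after \<open>i + 1\<close>.\<close>
  define m where "m = q * (N * N * r)"
  have A: "A \<in> carrier_mat (N * N) (N * N)" and B: "B \<in> carrier_mat m m"
    unfolding A_def B_def m_def
    by (auto intro!: kron_carrier simp: R_mat_def)
  have "N - i - 1 = (j - i - 2) + (1 + 1 + (N - j - 1))" "j - 1 = (i - 1) + (1 + 1 + (j - i - 2))"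
    using assms by auto
  then have "N ^ (N - i - 1) = m" "N ^ (j - 1) = p * (N * N * q)"
    by (simp_all only: m_def p_def q_def r_def power_add power_one_right)
  then have i: "T_mat N b \<xi> i \<beta> \<alpha> = kron (1\<^sub>m p) (kron A (1\<^sub>m m))"
    and j: "T_mat N b \<xi> j \<delta> \<gamma> = kron (1\<^sub>m p) (kron (1\<^sub>m (N * N)) B)"
    by (simp_all add: T_mat_eq_pad pad_def A_def B_def p_def r_def
        kron_one_mult_left)
  show ?thesis
    unfolding i j
    using kron_mult_kron[OF one_carrier_mat one_carrier_mat
        kron_carrier[OF A one_carrier_mat] kron_carrier[OF one_carrier_mat B], of p]
      kron_mult_kron[OF one_carrier_mat one_carrier_mat
        kron_carrier[OF one_carrier_mat B] kron_carrier[OF A one_carrier_mat], of p]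
      kron_commute[OF A B]
    by simp
qed

section \<open>The two-slot matrix as a two-term action\<close>

definition stay_coeff :: "(nat \<Rightarrow> complex) \<Rightarrow> nat \<Rightarrow> nat \<Rightarrow> complex" where
  "stay_coeff s i j = (if i \<le> j then s i else - 1)"

definition swap_coeff :: "(nat \<Rightarrow> complex) \<Rightarrow> nat \<Rightarrow> nat \<Rightarrow> complex" where
  "swap_coeff s i j = (if i < j then 1 + s i else 0)"

text \<open>The matrix \<open>R\<close> with an arbitrary function \<open>s\<close> in place of \<open>S\<^sub>\<beta>\<^sub>\<alpha>\<close> and \<open>1 + s\<close> in place of
  \<open>T\<^sub>\<beta>\<^sub>\<alpha>\<close>. Letters are counted from \<open>0\<close> here, so that a two-letter word \<open>ij\<close> has index
  \<open>i * N + j\<close>; the column \<open>r mod N * N + r div N\<close> belongs to the word of row \<open>r\<close> with its letters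
  swapped. For equal letters the two columns coincide, and the swap coefficient is \<open>0\<close>.\<close>

definition two_slot_mat :: "nat \<Rightarrow> (nat \<Rightarrow> complex) \<Rightarrow> complex mat" where
  "two_slot_mat N s = mat (N * N) (N * N) (\<lambda>(r, c).
     (if c = r then stay_coeff s (r div N) (r mod N) else 0) +
     (if c = r mod N * N + r div N then swap_coeff s (r div N) (r mod N) else 0))"

lemma two_slot_mat_carrier: "two_slot_mat N s \<in> carrier_mat (N * N) (N * N)"
  by (simp add: two_slot_mat_def)

lemma T_coeff_eq:
  assumes "1 - complex_of_real (b i) * \<xi> \<alpha> \<noteq> 0"
  shows "T_coeff b \<xi> \<beta> \<alpha> i = 1 + S_coeff b \<xi> \<beta> \<alpha> i"
  using assms by (simp add: T_coeff_def S_coeff_def field_simps)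

text \<open>The factor \<open>1 - b\<^sub>i \<xi>\<^sub>\<beta>\<close> cancels; the sign comes from multiplying two negated quotients.\<close>

lemma S_coeff_cocycle:
  assumes "1 - complex_of_real (b i) * \<xi> \<beta> \<noteq> 0"
  shows "S_coeff b \<xi> \<gamma> \<beta> i * S_coeff b \<xi> \<beta> \<alpha> i = - S_coeff b \<xi> \<gamma> \<alpha> i"
  using assms by (simp add: S_coeff_def) (metis minus_diff_eq minus_divide_left)

text \<open>Both sides are \<open>(\<xi>\<^sub>\<beta> - \<xi>\<^sub>\<alpha>) (\<xi>\<^sub>\<gamma> - \<xi>\<^sub>\<alpha>)\<close> times a factor symmetric in \<open>i\<close> and \<open>j\<close>. This is
  where it matters that \<open>1 - b\<^sub>i \<xi>\<close> depends on the label through an affine function of \<open>\<xi>\<close>.\<close>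

lemma S_coeff_exchange:
  assumes "1 - complex_of_real (b i) * \<xi> \<alpha> \<noteq> 0" "1 - complex_of_real (b j) * \<xi> \<alpha> \<noteq> 0"
  shows "(1 + S_coeff b \<xi> \<beta> \<alpha> i) * (1 + S_coeff b \<xi> \<gamma> \<alpha> j) =
    (1 + S_coeff b \<xi> \<beta> \<alpha> j) * (1 + S_coeff b \<xi> \<gamma> \<alpha> i)"
  by (simp only: T_coeff_eq[of b i \<xi> \<alpha>, OF assms(1), symmetric]
      T_coeff_eq[of b j \<xi> \<alpha>, OF assms(2), symmetric]) (simp add: T_coeff_def mult_ac)

text \<open>The shift by \<open>Suc\<close> converts letters counted from \<open>0\<close> to letters counted from \<open>1\<close>.\<close>

lemma R_mat_eq_two_slot_mat:
  fixes \<xi> :: "'l \<Rightarrow> complex" and \<alpha> \<beta> :: 'l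
  assumes "\<And>k. k \<in> {1..N} \<Longrightarrow> 1 - complex_of_real (b k) * \<xi> \<alpha> \<noteq> 0"
  defines "s \<equiv> \<lambda>i. S_coeff b \<xi> \<beta> \<alpha> (Suc i)"
  shows "R_mat N b \<xi> \<beta> \<alpha> = two_slot_mat N s"
proof (rule eq_matI)
  fix r c
  assume "r < dim_row (two_slot_mat N s)"
    "c < dim_col (two_slot_mat N s)"
  then have rc: "r < N * N" "c < N * N"
    by (auto simp: two_slot_mat_def)
  then have "N > 0"
    by (auto intro!: Nat.gr0I)
  define i j k l where "i = r div N" and "j = r mod N" and "k = c div N" and "l = c mod N"
  have r: "r = i * N + j" and c: "c = k * N + l" and ijkl: "i < N" "j < N" "k < N" "l < N"
    using rc \<open>N > 0\<close> by (auto simp: i_def j_def k_def l_def less_mult_imp_div_less)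
  have T: "T_coeff b \<xi> \<beta> \<alpha> (Suc i) = 1 + S_coeff b \<xi> \<beta> \<alpha> (Suc i)"
    by (intro T_coeff_eq assms(1)) (use ijkl in auto)
  have "word2 N r = (Suc i, Suc j)" "word2 N c = (Suc k, Suc l)"
    by (simp_all add: word2_def i_def j_def k_def l_def)
  then have "R_mat N b \<xi> \<beta> \<alpha> $$ (r, c)
      = R_entry b \<xi> \<beta> \<alpha> (Suc i, Suc j) (Suc k, Suc l)"
    using rc by (simp add: R_mat_def del: R_entry.simps)
  also have "\<dots> = (if k = i \<and> l = j then stay_coeff s i j else 0) +
      (if k = j \<and> l = i then swap_coeff s i j else 0)"
  proof -
    consider "k = i" "l = j" | "k = j" "l = i" "i \<noteq> j" | "\<not> (k = i \<and> l = j)" "\<not> (k = j \<and> l = i)"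
      by blast
    then show ?thesis
    proof cases
      case 1
      show ?thesis
        unfolding 1
        by (cases i j rule: linorder_cases) (simp_all add: stay_coeff_def swap_coeff_def s_def)
    next
      case 2
      show ?thesis
        unfolding 2(1,2) using 2(3) T
        by (cases i j rule: linorder_cases) (simp_all add: stay_coeff_def swap_coeff_def s_def)
    next
      case 3
      then have "(Suc i, Suc j) \<noteq> (Suc k, Suc l)" "(Suc i, Suc j) \<noteq> (Suc l, Suc k)"
        by auto
      with 3 show ?thesis
        by (simp only: R_entry.simps if_False simp_thms add_0)
    qed
  qed
  also have "\<dots> = two_slot_mat N s $$ (r, c)"
  proof -
    have "c = r \<longleftrightarrow> k = i \<and> l = j" "c = j * N + i \<longleftrightarrow> k = j \<and> l = i"
      unfolding r c using ijkl by (simp_all only: mult_add_eq_mult_add_iff)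
    then show ?thesis
      using rc by (simp add: two_slot_mat_def i_def[symmetric] j_def[symmetric] cong: if_cong split del: if_split)
  qed
  finally show "R_mat N b \<xi> \<beta> \<alpha> $$ (r, c) = two_slot_mat N s $$ (r, c)" .
qed (auto simp: R_mat_def two_slot_mat_def)

lemma index_two_slot_mat:
  assumes "i < N" "j < N" "c < N * N"
  shows "two_slot_mat N s $$ (i * N + j, c) =
     (if c = i * N + j then stay_coeff s i j else 0) + (if c = j * N + i then swap_coeff s i j else 0)"
proof -
  have "(i * N + j) div N = i" "(i * N + j) mod N = j"
    using assms by auto
  then show ?thesis
    using assms by (simp add: two_slot_mat_def mult_add_less_mult cong: if_cong split del: if_split)
qed

lemma two_term_row_mult:
  fixes A X :: "complex mat"
  assumes A: "A \<in> carrier_mat m n" and X: "X \<in> carrier_mat n k"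
    and "r < m" "c < k" "p < n" "q < n"
    and row: "\<And>t. t < n \<Longrightarrow> A $$ (r, t) = (if t = p then x else 0) + (if t = q then y else 0)"
  shows "(A * X) $$ (r, c) = x * X $$ (p, c) + y * X $$ (q, c)"
proof -
  have "(A * X) $$ (r, c) = (\<Sum>t = 0..<n. A $$ (r, t) * X $$ (t, c))"
    using assms by (auto simp: scalar_prod_def)
  also have "\<dots> = (\<Sum>t = 0..<n. (if t = p then x * X $$ (t, c) else 0) +
      (if t = q then y * X $$ (t, c) else 0))"
    by (rule sum.cong) (auto simp: row algebra_simps)
  also have "\<dots> = x * X $$ (p, c) + y * X $$ (q, c)"
    using assms by (simp add: sum.distrib sum.delta)
  finally show ?thesis .
qed

lemma two_slot_mat_mult_index:
  assumes "i < N" "j < N" "c < k" "X \<in> carrier_mat (N * N) k"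
  shows "(two_slot_mat N s * X) $$ (i * N + j, c) =
     stay_coeff s i j * X $$ (i * N + j, c) + swap_coeff s i j * X $$ (j * N + i, c)"
  by (rule two_term_row_mult[OF two_slot_mat_carrier assms(4)])
    (use assms in \<open>auto simp: mult_add_less_mult index_two_slot_mat\<close>)

text \<open>In a row \<open>ij\<close> with \<open>i < j\<close>, the coefficient of the swapped word is
  \<open>s i * (1 + t i) - (1 + s i)\<close>, which vanishes because \<open>s i * t i = 1\<close>.\<close>

lemma two_slot_mat_inverse:
  assumes st: "\<And>i. i < N \<Longrightarrow> s i * t i = 1"
  shows "two_slot_mat N s * two_slot_mat N t = 1\<^sub>m (N * N)"
proof (rule eq_matI)
  fix r c
  assume "r < dim_row (1\<^sub>m (N * N) :: complex mat)" "c < dim_col (1\<^sub>m (N * N) :: complex mat)"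
  then have rc: "r < N * N" "c < N * N"
    by auto
  then have "N > 0"
    by (auto intro!: Nat.gr0I)
  define i j where "i = r div N" and "j = r mod N"
  have r: "r = i * N + j" and ij: "i < N" "j < N"
    using rc \<open>N > 0\<close> by (auto simp: i_def j_def less_mult_imp_div_less)
  have "(two_slot_mat N s * two_slot_mat N t) $$ (r, c) = (if c = r then 1 else 0)"
    unfolding r two_slot_mat_mult_index[OF ij rc(2) two_slot_mat_carrier]
      index_two_slot_mat[OF ij rc(2)] index_two_slot_mat[OF ij(2,1) rc(2)]
    using st[OF ij(1)] ij rc(2)
    by (auto simp: mult_add_eq_mult_add_iff stay_coeff_def swap_coeff_def algebra_simps)
  then show "(two_slot_mat N s * two_slot_mat N t) $$ (r, c) = 1\<^sub>m (N * N) $$ (r, c)"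
    using rc by auto
qed (auto simp: two_slot_mat_def)

section \<open>The braid relation on three slots\<close>

lemma left_slots_mult_index:
  assumes ijk: "i < N" "j < N" "k < N" and c: "c < n" and X: "X \<in> carrier_mat (N * N * N) n"
  shows "(kron (two_slot_mat N s) (1\<^sub>m N) * X) $$ ((i * N + j) * N + k, c) =
     stay_coeff s i j * X $$ ((i * N + j) * N + k, c) +
     swap_coeff s i j * X $$ ((j * N + i) * N + k, c)"
proof (rule two_term_row_mult[OF _ X])
  fix t
  assume t: "t < N * N * N"
  then have "t div N < N * N"
    by (auto simp: less_mult_imp_div_less)
  moreover have "t = a * N + k \<longleftrightarrow> t div N = a \<and> t mod N = k" for a
    using ijk by auto
  ultimately show "kron (two_slot_mat N s) (1\<^sub>m N) $$ ((i * N + j) * N + k, t) =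
      (if t = (i * N + j) * N + k then stay_coeff s i j else 0) +
      (if t = (j * N + i) * N + k then swap_coeff s i j else 0)"
    using ijk t by (auto simp: index_kron[OF two_slot_mat_carrier one_carrier_mat]
        mult_add_less_mult index_two_slot_mat)
qed (use ijk c kron_carrier[OF two_slot_mat_carrier one_carrier_mat] in
    \<open>auto simp: mult_add_less_mult\<close>)

lemma right_slots_mult_index:
  assumes ijk: "i < N" "j < N" "k < N" and c: "c < n" and X: "X \<in> carrier_mat (N * N * N) n"
  shows "(kron (1\<^sub>m N) (two_slot_mat N s) * X) $$ ((i * N + j) * N + k, c) =
     stay_coeff s j k * X $$ ((i * N + j) * N + k, c) +
     swap_coeff s j k * X $$ ((i * N + k) * N + j, c)"
proof (rule two_term_row_mult[OF _ X])
  \<comment> \<open>\<open>I \<otimes> R\<close> splits a three-letter word after its first letter.\<close>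
  have regroup: "(i * N + a) * N + d = i * (N * N) + (a * N + d)" for a d
    by (simp add: algebra_simps)
  fix t
  assume t: "t < N * N * N"
  then have "t div (N * N) < N" "t mod (N * N) < N * N"
    using ijk by (auto simp: less_mult_imp_div_less mult.assoc)
  moreover note eq_mult_add_iff[of _ "N * N" t i]
  ultimately show "kron (1\<^sub>m N) (two_slot_mat N s) $$ ((i * N + j) * N + k, t) =
      (if t = (i * N + j) * N + k then stay_coeff s j k else 0) +
      (if t = (i * N + k) * N + j then swap_coeff s j k else 0)"
    unfolding regroup
    using ijk t by (auto simp: index_kron[OF one_carrier_mat two_slot_mat_carrier]
        mult_add_less_mult index_two_slot_mat mult.assoc)
qed (use ijk c kron_carrier[OF one_carrier_mat two_slot_mat_carrier] in
    \<open>auto simp: mult_add_less_mult mult.assoc[symmetric]\<close>)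

text \<open>The action of \<open>R \<otimes> I\<close>, and below that of \<open>I \<otimes> R\<close>, on functions of three letters.\<close>

definition left_act ::
    "(nat \<Rightarrow> complex) \<Rightarrow> (nat \<Rightarrow> nat \<Rightarrow> nat \<Rightarrow> complex) \<Rightarrow> nat \<Rightarrow> nat \<Rightarrow> nat \<Rightarrow> complex" where
  "left_act s f i j k = stay_coeff s i j * f i j k + swap_coeff s i j * f j i k"

definition right_act ::
    "(nat \<Rightarrow> complex) \<Rightarrow> (nat \<Rightarrow> nat \<Rightarrow> nat \<Rightarrow> complex) \<Rightarrow> nat \<Rightarrow> nat \<Rightarrow> nat \<Rightarrow> complex" where
  "right_act s f i j k = stay_coeff s j k * f i j k + swap_coeff s j k * f i k j"

text \<open>Both sides are linear combinations of the values of \<open>f\<close> at the rearrangements of \<open>ijk\<close>. For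
  \<open>i < j < k\<close>, for example, the coefficients of \<open>f i j k\<close> are \<open>s i * u j * t i\<close> and
  \<open>t j * u i * s j\<close>, which agree because \<open>u = - s t\<close>. The coefficients of \<open>f j i k\<close> agree only by
  the exchange hypothesis: their difference is \<open>s i\<close> times the difference of its two sides.\<close>

lemma act_braid:
  assumes u: "u i = - (s i * t i)" "u j = - (s j * t j)" "u k = - (s k * t k)"
    and exchange: "(1 + t i) * (1 + u j) = (1 + t j) * (1 + u i)"
  shows "left_act s (right_act u (left_act t f)) i j k =
    right_act t (left_act u (right_act s f)) i j k" (is "?l = ?r")
proof -
  \<comment> \<open>The first factor collects, for each order of the letters, the values of \<open>f\<close> whose coefficients
    agree only by the exchange hypothesis. For \<open>j = k\<close>, the words \<open>kij\<close> and \<open>jik\<close> coincide, and for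
    \<open>i = k\<close>, so do \<open>ikj\<close> and \<open>kij\<close>; each such pair then contributes one term.\<close>
  have "?l - ?r = (if i < j \<and> j \<le> k then s i * ((if j < k then f k i j else 0) + f j i k)
      else if j < i \<and> i \<le> k then - (f i k j + (if i < k then f k i j else 0)) else 0) *
    ((1 + t i) * (1 + u j) - (1 + t j) * (1 + u i))"
    by (cases rule: linorder_cases[of i j]; cases rule: linorder_cases[of j k];
        cases rule: linorder_cases[of i k];
        simp add: left_act_def right_act_def stay_coeff_def swap_coeff_def u algebra_simps)
  then show ?thesis
    by (simp add: exchange)
qed

text \<open>The identity matrix is appended to both products so that each entry is obtained by three
  successive two-term actions on one of its columns, regarded as a function of three letters.\<close>

lemma two_slot_mat_braid:
  assumes u: "\<And>i. i < N \<Longrightarrow> u i = - (s i * t i)"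
    and exchange: "\<And>i j. i < N \<Longrightarrow> j < N \<Longrightarrow> (1 + t i) * (1 + u j) = (1 + t j) * (1 + u i)"
  defines "L \<equiv> \<lambda>x. kron (two_slot_mat N x) (1\<^sub>m N)"
    and "R \<equiv> \<lambda>x. kron (1\<^sub>m N) (two_slot_mat N x)"
  shows "L s * R u * L t = R t * L u * R s"
proof -
  let ?n = "N * N * N"
  have L: "L x \<in> carrier_mat ?n ?n" and R: "R x \<in> carrier_mat ?n ?n" for x
    using kron_carrier[OF two_slot_mat_carrier one_carrier_mat, of N x N]
      kron_carrier[OF one_carrier_mat two_slot_mat_carrier, of N N x]
    by (auto simp: L_def R_def mult.assoc)
  note carriers = L R mult_carrier_mat[OF L] mult_carrier_mat[OF R] one_carrier_mat
  have L_index: "(L x * X) $$ ((i * N + j) * N + k, c) =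
      stay_coeff x i j * X $$ ((i * N + j) * N + k, c) +
      swap_coeff x i j * X $$ ((j * N + i) * N + k, c)"
    if "i < N" "j < N" "k < N" "c < ?n" "X \<in> carrier_mat ?n ?n" for x X i j k c
    unfolding L_def using that by (rule left_slots_mult_index)
  have R_index: "(R x * X) $$ ((i * N + j) * N + k, c) =
      stay_coeff x j k * X $$ ((i * N + j) * N + k, c) +
      swap_coeff x j k * X $$ ((i * N + k) * N + j, c)"
    if "i < N" "j < N" "k < N" "c < ?n" "X \<in> carrier_mat ?n ?n" for x X i j k c
    unfolding R_def using that by (rule right_slots_mult_index)
  have "L s * (R u * (L t * 1\<^sub>m ?n)) = R t * (L u * (R s * 1\<^sub>m ?n))" (is "?lhs = ?rhs")
  proof (rule eq_matI)
    fix r c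
    assume "r < dim_row ?rhs" "c < dim_col ?rhs"
    then have rc: "r < ?n" "c < ?n"
      using R[of t] by auto
    then have "N > 0"
      by (auto intro!: Nat.gr0I)
    define i j k where "i = r div N div N" and "j = r div N mod N" and "k = r mod N"
    have r: "r = (i * N + j) * N + k" and ijk: "i < N" "j < N" "k < N"
      using rc \<open>N > 0\<close> by (auto simp: i_def j_def k_def less_mult_imp_div_less)
    define f where "f = (\<lambda>i j k. 1\<^sub>m ?n $$ ((i * N + j) * N + k, c) :: complex)"
    have f: "1\<^sub>m ?n $$ ((i * N + j) * N + k, c) = f i j k" for i j k
      by (simp add: f_def)
    show "?lhs $$ (r, c) = ?rhs $$ (r, c)"
      unfolding r
      using act_braid[of u i s t j k f, OF u u u exchange] ijk
      by (simp add: left_act_def right_act_def L_index R_index f carriers rc(2)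
          del: right_mult_one_mat index_mult_mat index_one_mat)
  qed (simp_all add: carrier_matD[OF L] carrier_matD[OF R])
  then show ?thesis
    by (simp add: assoc_mult_mat[OF L R L] assoc_mult_mat[OF R L R] right_mult_one_mat[OF L]
        right_mult_one_mat[OF R])
qed

section \<open>The consistency relations\<close>

theorem lemma1p1:
  fixes N :: nat and b :: "nat \<Rightarrow> real" and \<xi> :: "'l \<Rightarrow> complex" and \<alpha> \<beta> \<gamma> \<delta> :: 'l
  assumes b_pos: "\<And>k. k \<in> {1..N} \<Longrightarrow> b k > 0"
    and nonsing: "\<And>\<kappa> k. \<kappa> \<in> {\<alpha>, \<beta>, \<gamma>, \<delta>} \<Longrightarrow> k \<in> {1..N} \<Longrightarrow> \<xi> \<kappa> \<noteq> 1 / complex_of_real (b k)"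
  shows "(\<forall>i\<in>{1..N - 1}. \<forall>j\<in>{1..N - 1}. \<bar>int i - int j\<bar> \<ge> 2 \<longrightarrow>
            T_mat N b \<xi> i \<beta> \<alpha> * T_mat N b \<xi> j \<delta> \<gamma> = T_mat N b \<xi> j \<delta> \<gamma> * T_mat N b \<xi> i \<beta> \<alpha>)
       \<and> (\<forall>i\<in>{1..N - 1}. \<forall>j\<in>{1..N - 1}. \<bar>int i - int j\<bar> = 1 \<and> i < j \<longrightarrow>
            T_mat N b \<xi> i \<gamma> \<beta> * T_mat N b \<xi> j \<gamma> \<alpha> * T_mat N b \<xi> i \<beta> \<alpha>
              = T_mat N b \<xi> j \<beta> \<alpha> * T_mat N b \<xi> i \<gamma> \<alpha> * T_mat N b \<xi> j \<gamma> \<beta>)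
       \<and> (\<forall>i\<in>{1..N - 1}. T_mat N b \<xi> i \<beta> \<alpha> * T_mat N b \<xi> i \<alpha> \<beta> = 1\<^sub>m (N ^ N))"
proof -
  let ?labels = "{\<alpha>, \<beta>, \<gamma>, \<delta>}"
  have nz: "1 - complex_of_real (b k) * \<xi> \<kappa> \<noteq> 0" if "\<kappa> \<in> ?labels" "k \<in> {1..N}" for \<kappa> k
    using b_pos[OF that(2)] nonsing[OF that] by (auto simp: field_simps)
  define s where "s \<kappa> \<mu> = (\<lambda>i. S_coeff b \<xi> \<kappa> \<mu> (Suc i))" for \<kappa> \<mu>
  have T: "T_mat N b \<xi> l \<kappa> \<mu> = pad (N ^ (l - 1)) (N ^ (N - l - 1)) (two_slot_mat N (s \<kappa> \<mu>))"
    if "\<mu> \<in> ?labels" for l \<kappa> \<mu>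
    unfolding T_mat_eq_pad s_def by (subst R_mat_eq_two_slot_mat) (use nz that in auto)

  have far: "T_mat N b \<xi> i \<beta> \<alpha> * T_mat N b \<xi> j \<delta> \<gamma> = T_mat N b \<xi> j \<delta> \<gamma> * T_mat N b \<xi> i \<beta> \<alpha>"
    if "i \<in> {1..N - 1}" "j \<in> {1..N - 1}" "\<bar>int i - int j\<bar> \<ge> 2" for i j
  proof (cases "i < j")
    case True
    then show ?thesis
      using that by (intro T_mat_commute) auto
  next
    case False
    then show ?thesis
      using that by (intro T_mat_commute[symmetric]) auto
  qed

  have braid: "T_mat N b \<xi> i \<gamma> \<beta> * T_mat N b \<xi> j \<gamma> \<alpha> * T_mat N b \<xi> i \<beta> \<alpha>
      = T_mat N b \<xi> j \<beta> \<alpha> * T_mat N b \<xi> i \<gamma> \<alpha> * T_mat N b \<xi> j \<gamma> \<beta>"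
    if "i \<in> {1..N - 1}" "j \<in> {1..N - 1}" "\<bar>int i - int j\<bar> = 1 \<and> i < j" for i j
  proof -
    \<comment> \<open>The common block consists of the slots \<open>i\<close>, \<open>j = i + 1\<close> and \<open>i + 2\<close>.\<close>
    define p q where "p = N ^ (i - 1)" and "q = N ^ (N - j - 1)"
    define L where "L x = kron (two_slot_mat N x) (1\<^sub>m N)" for x
    define R where "R x = kron (1\<^sub>m N) (two_slot_mat N x)" for x
    have "N - i - 1 = 1 + (N - j - 1)" "j - 1 = (i - 1) + 1"
      using that by auto
    then have powers: "N ^ (N - i - 1) = N * q" "N ^ (j - 1) = p * N"
      by (simp_all only: p_def q_def power_add power_one_right)
    have i: "T_mat N b \<xi> i \<kappa> \<mu> = pad p q (L (s \<kappa> \<mu>))"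
      and j: "T_mat N b \<xi> j \<kappa> \<mu> = pad p q (R (s \<kappa> \<mu>))" if "\<mu> \<in> ?labels" for \<kappa> \<mu>
      unfolding T[OF that] powers p_def[symmetric] q_def[symmetric] L_def R_def
      by (rule pad_mult_right pad_mult_left)+
    have L: "L x \<in> carrier_mat (N * N * N) (N * N * N)" for x
      unfolding L_def by (intro kron_carrier two_slot_mat_carrier one_carrier_mat)
    have R: "R x \<in> carrier_mat (N * N * N) (N * N * N)" for x
      unfolding R_def mult.assoc by (intro kron_carrier two_slot_mat_carrier[unfolded mult.assoc] one_carrier_mat)
    have "L (s \<gamma> \<beta>) * R (s \<gamma> \<alpha>) * L (s \<beta> \<alpha>) = R (s \<beta> \<alpha>) * L (s \<gamma> \<alpha>) * R (s \<gamma> \<beta>)"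
      unfolding L_def R_def
    proof (rule two_slot_mat_braid)
      show "s \<gamma> \<alpha> k = - (s \<gamma> \<beta> k * s \<beta> \<alpha> k)" if "k < N" for k
        using S_coeff_cocycle[of b "Suc k" \<xi> \<beta> \<gamma> \<alpha>] nz[of \<beta> "Suc k"] that by (simp add: s_def)
      show "(1 + s \<beta> \<alpha> k) * (1 + s \<gamma> \<alpha> l) = (1 + s \<beta> \<alpha> l) * (1 + s \<gamma> \<alpha> k)"
        if "k < N" "l < N" for k l
        unfolding s_def by (rule S_coeff_exchange; rule nz) (use that in auto)
    qed
    then show ?thesis
      by (simp add: i j pad_mult[OF L R] pad_mult[OF R L] pad_mult[OF mult_carrier_mat[OF L R] L]
          pad_mult[OF mult_carrier_mat[OF R L] R])
  qed

  have inverse: "T_mat N b \<xi> i \<beta> \<alpha> * T_mat N b \<xi> i \<alpha> \<beta> = 1\<^sub>m (N ^ N)"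
    if "i \<in> {1..N - 1}" for i
  proof -
    have "s \<beta> \<alpha> k * s \<alpha> \<beta> k = 1" if "k < N" for k
      using S_coeff_cocycle[of b "Suc k" \<xi> \<alpha> \<beta> \<beta>] nz[of \<alpha> "Suc k"] nz[of \<beta> "Suc k"] that
      by (simp add: s_def S_coeff_def[of b \<xi> \<beta> \<beta>])
    then have "two_slot_mat N (s \<beta> \<alpha>) * two_slot_mat N (s \<alpha> \<beta>) = 1\<^sub>m (N * N)"
      by (rule two_slot_mat_inverse)
    moreover have "N ^ (i - 1) * (N * N * N ^ (N - i - 1)) = N ^ N"
    proof -
      have "N ^ (i - 1) * (N * N * N ^ (N - i - 1)) = N ^ ((i - 1) + (1 + 1 + (N - i - 1)))"
        by (simp only: power_add power_one_right)
      also have "(i - 1) + (1 + 1 + (N - i - 1)) = N"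
        using that by auto
      finally show ?thesis .
    qed
    ultimately show ?thesis
      by (simp only: T insert_iff simp_thms pad_mult[OF two_slot_mat_carrier two_slot_mat_carrier] pad_one)
  qed

  show ?thesis
    using far braid inverse by blast
qed

end
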